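(* Let $a,b,c\in\mathbb{C}$ be noncollinear, let $T$ be the triangle with vertices $a,b,c$, let $f(z)=(z-a)(z-b)(z-c)$, and suppose $\mathtt{B}_\triangle\neq 0$. Then the five critical points of the Gaussian curvature $K$ of the graph of $f$ (regarded as a function of $z\in\mathbb{C}\cong\mathbb{R}^2$) are located along both axes (the lines containing the major and minor axes) of the Siebeck-Marden ellipse of $T$. In particular, the barycenter $\mathtt{b}_\triangle$, which is one of these critical points, is the center of the ellipse.
   Context: Notation: $\mathtt{b}_\triangle=\frac{a+b+c}{3}$ is the barycenter of $T$ and $\mathtt{B}_\triangle=\mathtt{b}_\triangle^2-\frac{ab+ac+bc}{3}$. The graph $\Gamma(f)=\{(z,f(z)):z\in\mathbb{C}\}\subset\mathbb{C}^2\cong\mathbb{R}^4$ carries the metric induced from $\mathbb{R}^4$; its Gaussian curvature at $(z,f(z))$ is $$K(z)=-\frac{8}{81}\,\frac{|z-\mathtt{b}_\triangle|^2}{\left[\frac19+\left|(z-\mathtt{b}_\triangle)^2-\mathtt{B}_\triangle\right|^2\right]^3}.$$ When $\mathtt{B}_\triangle\ne0$, $K$ has exactly five critical points (points of $\mathbb{R}^2$ where $K_x=K_y=0$). The Siebeck-Marden ellipse of $T$ is the ellipse inscribed in $T$ and tangent to the sides of $T$ at their midpoints; by the Siebeck-Marden theorem its foci are the roots $\mathtt{b}_\triangle\pm\sqrt{\mathtt{B}_\triangle}$ of $f'$. *)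

theory Defs
  imports "HOL-Analysis.Analysis"
begin

section \<open>Gaussian curvature of a surface parametrised by the complex plane\<close>

text \<open>
  The plane is identified with \<open>\<real>\<^sup>2\<close> through the frame \<open>1\<close>, \<open>\<i>\<close>, and \<open>\<complex>\<^sup>2\<close> with the Euclidean space
  \<open>\<real>\<^sup>4\<close> through the inner product of the type \<open>complex \<times> complex\<close>.
  Indices range over the two-element type \<open>2\<close>.
\<close>

definition frame :: "2 \<Rightarrow> complex" where
  "frame i = (if i = 1 then 1 else \<i>)"

definition partial :: "2 \<Rightarrow> (complex \<Rightarrow> 'a::real_normed_vector) \<Rightarrow> complex \<Rightarrow> 'a" where
  "partial i h z = vector_derivative (\<lambda>t. h (z + t *\<^sub>R frame i)) (at 0)"

definition induced_metric :: "(complex \<Rightarrow> 'a::real_inner) \<Rightarrow> complex \<Rightarrow> real^2^2" where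
  "induced_metric X z = (\<chi> i j. partial i X z \<bullet> partial j X z)"

text \<open>\<open>christoffel g k i j\<close> is \<open>\<Gamma>\<^sup>k\<^bsub>ij\<^esub>\<close>.\<close>

definition christoffel :: "(complex \<Rightarrow> real^2^2) \<Rightarrow> 2 \<Rightarrow> 2 \<Rightarrow> 2 \<Rightarrow> complex \<Rightarrow> real" where
  "christoffel g k i j z =
     (\<Sum>l\<in>UNIV. matrix_inv (g z) $ k $ l *
        (partial i (\<lambda>w. g w $ j $ l) z + partial j (\<lambda>w. g w $ i $ l) z
          - partial l (\<lambda>w. g w $ i $ j) z)) / 2"

text \<open>\<open>riemann g l k i j\<close> is the component along \<open>\<partial>\<^sub>l\<close> of \<open>R(\<partial>\<^sub>i, \<partial>\<^sub>j) \<partial>\<^sub>k\<close>, with the convention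
  \<open>R(X, Y) = [\<nabla>\<^sub>X, \<nabla>\<^sub>Y] - \<nabla>\<^bsub>[X,Y]\<^esub>\<close>.\<close>

definition riemann :: "(complex \<Rightarrow> real^2^2) \<Rightarrow> 2 \<Rightarrow> 2 \<Rightarrow> 2 \<Rightarrow> 2 \<Rightarrow> complex \<Rightarrow> real" where
  "riemann g l k i j z =
     partial i (christoffel g l j k) z - partial j (christoffel g l i k) z
     + (\<Sum>m\<in>UNIV. christoffel g l i m z * christoffel g m j k z
                  - christoffel g l j m z * christoffel g m i k z)"

definition gaussian_curvature :: "(complex \<Rightarrow> real^2^2) \<Rightarrow> complex \<Rightarrow> real" where
  "gaussian_curvature g z = (\<Sum>l\<in>UNIV. g z $ 1 $ l * riemann g l 2 1 2 z) / det (g z)"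

definition graph_curvature :: "(complex \<Rightarrow> complex) \<Rightarrow> complex \<Rightarrow> real" where
  "graph_curvature f = gaussian_curvature (induced_metric (\<lambda>z. (z, f z)))"

definition critical_points :: "(complex \<Rightarrow> real) \<Rightarrow> complex set" where
  "critical_points h =
     {z. \<forall>i. ((\<lambda>t. h (z + t *\<^sub>R frame i)) has_real_derivative 0) (at 0)}"


section \<open>The triangle and its cubic polynomial\<close>

definition cubic :: "complex \<Rightarrow> complex \<Rightarrow> complex \<Rightarrow> complex \<Rightarrow> complex" where
  "cubic a b c z = (z - a) * (z - b) * (z - c)"

definition barycenter :: "complex \<Rightarrow> complex \<Rightarrow> complex \<Rightarrow> complex" where
  "barycenter a b c = (a + b + c) / 3"

definition B_tri :: "complex \<Rightarrow> complex \<Rightarrow> complex \<Rightarrow> complex" where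
  "B_tri a b c = (barycenter a b c)\<^sup>2 - (a * b + a * c + b * c) / 3"


section \<open>Ellipses\<close>

text \<open>
  An ellipse is given by its center, a unit vector along its major axis, and its two semi-axes;
  the constraints on these data are collected in \<open>is_ellipse\<close>. Circles are included.
\<close>

datatype ellipse =
  Ellipse (center: complex) (major_dir: complex) (semi_major: real) (semi_minor: real)

definition is_ellipse :: "ellipse \<Rightarrow> bool" where
  "is_ellipse E \<longleftrightarrow>
     norm (major_dir E) = 1 \<and> 0 < semi_minor E \<and> semi_minor E \<le> semi_major E"

definition ellipse_path :: "ellipse \<Rightarrow> real \<Rightarrow> complex" where
  "ellipse_path E t =
     center E + (semi_major E * cos t) *\<^sub>R major_dir E
              + (semi_minor E * sin t) *\<^sub>R (\<i> * major_dir E)"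

definition major_axis_line :: "ellipse \<Rightarrow> complex set" where
  "major_axis_line E = range (\<lambda>s::real. center E + s *\<^sub>R major_dir E)"

definition minor_axis_line :: "ellipse \<Rightarrow> complex set" where
  "minor_axis_line E = range (\<lambda>s::real. center E + s *\<^sub>R (\<i> * major_dir E))"

definition tangent_line_at :: "ellipse \<Rightarrow> real \<Rightarrow> complex set" where
  "tangent_line_at E t =
     range (\<lambda>s::real. ellipse_path E t + s *\<^sub>R vector_derivative (ellipse_path E) (at t))"

definition tangent_to_side_at_midpoint :: "ellipse \<Rightarrow> complex \<Rightarrow> complex \<Rightarrow> bool" where
  "tangent_to_side_at_midpoint E p q \<longleftrightarrow>
     (\<exists>t. ellipse_path E t = midpoint p q \<and> tangent_line_at E t = affine hull {p, q})"

definition siebeck_marden_ellipse :: "complex \<Rightarrow> complex \<Rightarrow> complex \<Rightarrow> ellipse \<Rightarrow> bool" where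
  "siebeck_marden_ellipse a b c E \<longleftrightarrow>
     is_ellipse E \<and>
     range (ellipse_path E) \<subseteq> convex hull {a, b, c} \<and>
     tangent_to_side_at_midpoint E a b \<and>
     tangent_to_side_at_midpoint E b c \<and>
     tangent_to_side_at_midpoint E c a"


section \<open>Closed form of the curvature of the graph\<close>

text \<open>Nothing above depends on this section. It checks that the intrinsic definition of the curvature
  gives the explicit formula \<open>K(z) = -(8/81) |z - b|\<^sup>2 / (1/9 + |(z - b)\<^sup>2 - B|\<^sup>2)\<^sup>3\<close>.\<close>

lemma partial_eqI:
  "((\<lambda>t. h (z + t *\<^sub>R frame i)) has_vector_derivative d) (at 0) \<Longrightarrow> partial i h z = d"
  by (simp add: partial_def vector_derivative_at)

lemma line_deriv:
  assumes "(f has_field_derivative d) (at z)"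
  shows "((\<lambda>t. f (z + t *\<^sub>R v)) has_vector_derivative d * v) (at (0::real))"
proof -
  have l: "((\<lambda>t. z + t *\<^sub>R v) has_vector_derivative v) (at (0::real))"
    by (auto intro!: derivative_eq_intros)
  show ?thesis
    using field_vector_diff_chain_at[OF l, of f d] assms by (simp add: o_def mult.commute)
qed

lemma gaussian_curvature_holomorphic_graph:
  assumes f: "\<And>z. (f has_field_derivative g z) (at z)"
    and g: "\<And>z. (g has_field_derivative g' z) (at z)"
    and g': "\<And>z. (g' has_field_derivative g'' z) (at z)"
  shows "graph_curvature f z = - 2 * (norm (g' z))\<^sup>2 / (1 + (norm (g z))\<^sup>2) ^ 3"
proof -
  define L where "L = (\<lambda>z. 1 + g z \<bullet> g z)"
  define P where "P = (\<lambda>i z. (g z \<bullet> (g' z * frame i)) / L z)"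
  define G where "G = induced_metric (\<lambda>z. (z, f z))"
  have Lpos: "L z > 0" for z unfolding L_def by (simp add: add_pos_nonneg)
  have pX: "partial i (\<lambda>z. (z, f z)) z = (frame i, g z * frame i)" for i z
    apply (rule partial_eqI)
    apply (rule has_vector_derivative_Pair)
     apply (auto intro!: derivative_eq_intros line_deriv f)
    done
  have fr: "frame 1 = 1" "frame 2 = \<i>" by (simp_all add: frame_def)
  have G: "G z = (\<chi> i j. if i = j then L z else 0)" for z
    unfolding G_def induced_metric_def pX
    by (simp add: vec_eq_iff forall_2 fr L_def inner_complex_def algebra_simps power2_eq_square)
  have Gij: "G z $ i $ j = (if i = j then L z else 0)" for z i j by (simp add: G)
  have inv: "matrix_inv (G z) = (\<chi> i j. if i = j then 1 / L z else 0)" for z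
  proof -
    define J :: "real^2^2" where "J = (\<chi> i j. if i = j then 1 / L z else 0)"
    have J: "G z ** J = mat 1" "J ** G z = mat 1"
      using Lpos[of z] by (simp_all add: G J_def matrix_matrix_mult_def vec_eq_iff forall_2 sum_2 mat_def)
    then have "invertible (G z)" unfolding invertible_def by blast
    then have "matrix_inv (G z) = matrix_inv (G z) ** (G z ** J)" by (simp add: J)
    also have "\<dots> = J" using \<open>invertible (G z)\<close> 
      unfolding matrix_mul_assoc matrix_inv_def invertible_def by (metis (mono_tags, lifting) matrix_mul_lid someI_ex)
    finally show ?thesis by (simp add: J_def)
  qed
  have dL: "((\<lambda>t. L (z + t *\<^sub>R v)) has_vector_derivative 2 * (g z \<bullet> (g' z * v))) (at (0::real))" for z v
  proof -
    have "((\<lambda>t. g (z + t *\<^sub>R v) \<bullet> g (z + t *\<^sub>R v)) has_vector_derivative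
       (g (z + 0 *\<^sub>R v) \<bullet> (g' z * v) + (g' z * v) \<bullet> g (z + 0 *\<^sub>R v))) (at (0::real))"
      by (rule bounded_bilinear.has_vector_derivative[OF bounded_bilinear_inner line_deriv[OF g] line_deriv[OF g]])
    then show ?thesis unfolding L_def
      by (auto intro!: derivative_eq_intros simp: inner_commute)
  qed
  have pL: "partial i (\<lambda>w. G w $ j $ k) z = (if j = k then 2 * L z * P i z else 0)" for i j k z
    apply (rule partial_eqI)
    using dL[of z "frame i"] Lpos[of z] by (simp add: Gij P_def)
  have chr: "christoffel G k i j = (\<lambda>z. (if j = k then P i z else 0) + (if i = k then P j z else 0)
      - (if i = j then P k z else 0))" for k i j
    using Lpos less_irrefl unfolding christoffel_def pL inv
    apply (intro ext)
    apply (cases k rule: exhaust_2[THEN disjE]; cases i rule: exhaust_2[THEN disjE]; cases j rule: exhaust_2[THEN disjE])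
    by (simp_all add: sum_2 less_imp_neq[OF Lpos, symmetric])
  have dP: "((\<lambda>t. P i (z + t *\<^sub>R v)) has_vector_derivative
      ((g' z * v) \<bullet> (g' z * frame i) + g z \<bullet> (g'' z * v * frame i)) / L z
        - 2 * (g z \<bullet> (g' z * frame i)) * (g z \<bullet> (g' z * v)) / (L z)\<^sup>2) (at (0::real))" for i z v
  proof -
    have 1: "((\<lambda>t. g (z + t *\<^sub>R v) \<bullet> (g' (z + t *\<^sub>R v) * frame i)) has_vector_derivative
       (g (z + 0 *\<^sub>R v) \<bullet> (g'' z * v * frame i) + (g' z * v) \<bullet> (g' (z + 0 *\<^sub>R v) * frame i))) (at (0::real))"
      by (intro bounded_bilinear.has_vector_derivative[OF bounded_bilinear_inner] line_deriv[OF g]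
          has_vector_derivative_mult_left line_deriv[OF g'])
    have ne: "L (z + 0 *\<^sub>R v) \<noteq> 0" using Lpos[of z] by simp
    show ?thesis
      unfolding P_def has_real_derivative_iff_has_vector_derivative[symmetric]
      apply (rule DERIV_cong)
       apply (rule DERIV_divide[OF 1[folded has_real_derivative_iff_has_vector_derivative]
          dL[of z v, folded has_real_derivative_iff_has_vector_derivative] ne])
      using Lpos[of z] by (simp add: field_simps power2_eq_square)
  qed
  have ndP: "((\<lambda>t. - P i (z + t *\<^sub>R v)) has_vector_derivative
      -(((g' z * v) \<bullet> (g' z * frame i) + g z \<bullet> (g'' z * v * frame i)) / L z
        - 2 * (g z \<bullet> (g' z * frame i)) * (g z \<bullet> (g' z * v)) / (L z)\<^sup>2)) (at (0::real))" for i z v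
    by (intro has_vector_derivative_minus dP)
  have R1: "riemann G 1 2 1 2 z = 
     - (g' z \<bullet> g' z + g z \<bullet> g'' z) / L z + 2 * (g z \<bullet> g' z)\<^sup>2 / (L z)\<^sup>2
     - ((g' z * \<i>) \<bullet> (g' z * \<i>) - g z \<bullet> g'' z) / L z + 2 * (g z \<bullet> (g' z * \<i>))\<^sup>2 / (L z)\<^sup>2"
    unfolding riemann_def chr sum_2
    by (simp add: partial_eqI[OF dP] partial_eqI[OF ndP] fr algebra_simps power2_eq_square 
      add_divide_distrib diff_divide_distrib)
  have n: "(norm (w::complex))\<^sup>2 = w \<bullet> w" for w by (simp add: power2_norm_eq_inner)
  have s: "(g z \<bullet> g' z)\<^sup>2 + (g z \<bullet> (g' z * \<i>))\<^sup>2 = (L z - 1) * (g' z \<bullet> g' z)"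
    unfolding L_def by (simp add: inner_complex_def algebra_simps power2_eq_square)
  have s2: "(g' z * \<i>) \<bullet> (g' z * \<i>) = g' z \<bullet> g' z" by (simp add: inner_complex_def)
  have "riemann G 1 2 1 2 z = - 2 * (g' z \<bullet> g' z) / L z + 2 * ((g z \<bullet> g' z)\<^sup>2 + (g z \<bullet> (g' z * \<i>))\<^sup>2) / (L z)\<^sup>2"
    unfolding R1 s2 by (simp add: field_simps add_divide_distrib diff_divide_distrib)
  also have "\<dots> = - 2 * (g' z \<bullet> g' z) / (L z)\<^sup>2"
    unfolding s using Lpos[of z] by (simp add: field_simps power2_eq_square)
  finally have R: "riemann G 1 2 1 2 z = - 2 * (g' z \<bullet> g' z) / (L z)\<^sup>2" .
  have "graph_curvature f z = L z * (- 2 * (g' z \<bullet> g' z) / (L z)\<^sup>2) / (L z * L z)"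
    unfolding graph_curvature_def G_def[symmetric] gaussian_curvature_def
    by (simp add: sum_2 Gij det_2 R)
  also have "\<dots> = - 2 * (g' z \<bullet> g' z) / (L z) ^ 3"
    using Lpos[of z] by (simp add: field_simps power2_eq_square power3_eq_cube)
  finally show ?thesis unfolding L_def n .
qed

lemma graph_curvature_cubic:
  "graph_curvature (cubic a b c) z =
     - (8 / 81) * (norm (z - barycenter a b c))\<^sup>2 /
       (1 / 9 + (norm ((z - barycenter a b c)\<^sup>2 - B_tri a b c))\<^sup>2) ^ 3"
proof -
  let ?m = "barycenter a b c" and ?B = "B_tri a b c"
  have m: "a + b + c = 3 * ?m" by (simp add: barycenter_def)
  have e: "(w - b) * (w - c) + (w - a) * (w - c) + (w - a) * (w - b) = 3 * ((w - ?m)\<^sup>2 - ?B)" for w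
    unfolding B_tri_def barycenter_def by (simp add: power2_eq_square field_simps)
  have 1: "(cubic a b c has_field_derivative 3 * ((w - ?m)\<^sup>2 - ?B)) (at w)" for w
    unfolding cubic_def[abs_def] e[symmetric]
    by (auto intro!: derivative_eq_intros simp: algebra_simps)
  have 2: "((\<lambda>w. 3 * ((w - ?m)\<^sup>2 - ?B)) has_field_derivative 6 * (w - ?m)) (at w)" for w
    by (auto intro!: derivative_eq_intros)
  have 3: "((\<lambda>w. 6 * (w - ?m)) has_field_derivative 6) (at w)" for w
    by (auto intro!: derivative_eq_intros)
  define n where "n = (norm (z - ?m))\<^sup>2"
  define q where "q = (norm ((z - ?m)\<^sup>2 - ?B))\<^sup>2"
  have q: "q \<ge> 0" by (simp add: q_def)
  have "graph_curvature (cubic a b c) z = - 72 * n / (1 + 9 * q) ^ 3"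
    using gaussian_curvature_holomorphic_graph[OF 1 2 3, of z]
    by (simp only: n_def q_def norm_mult power_mult_distrib norm_numeral) simp
  also have "(1 + 9 * q) ^ 3 = 729 * (1 / 9 + q) ^ 3"
    by (simp add: power3_eq_cube field_simps)
  finally show ?thesis by (simp add: n_def q_def)
qed

end

theory Submission
  imports Defs
begin

text \<open>
  Write \<open>w = z - b\<close> with \<open>b\<close> the barycenter. Up to a constant the curvature is \<open>|w|\<^sup>2 / D\<^sup>3\<close> with
  \<open>D = 1/9 + |w\<^sup>2 - B|\<^sup>2\<close>, a function that depends on the triangle only through \<open>B\<close>. Rotating \<open>w\<close>
  by a unit \<open>u\<close> with \<open>u\<^sup>2 = B / |B|\<close> makes \<open>B\<close> a positive real \<open>\<beta>\<close>, and in the rotated coordinates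
  \<open>x + i y\<close> the two critical point equations are \<open>x\<close> and \<open>y\<close> times brackets that differ by
  \<open>12 \<beta> (x\<^sup>2 + y\<^sup>2)\<close>. They cannot vanish together away from the origin, so \<open>x = 0\<close> or \<open>y = 0\<close>;
  on either axis what is left is a quadratic in the squared coordinate with exactly one positive
  root. This gives the origin and one symmetric pair on each axis: five points in all
  (\<open>critical_points_on_axes\<close>).

  It remains to see that the directions \<open>u\<close> and \<open>i u\<close> are those of the axes of the Siebeck-Marden
  ellipse. An ellipse is the image of the unit circle under the affine map \<open>chart\<close>. Pulling the
  triangle back by it gives a triangle whose sides touch the unit circle at their midpoints. Such a
  triangle is equilateral with circumradius 2 (\<open>siebeck_marden_chart_equilateral\<close>), hence its
  vertices have sum zero and squares with sum zero. Since \<open>6 B\<close> is the sum of the squares of the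
  centered vertices, pushing forward yields \<open>B = v\<^sup>2 (A\<^sup>2 - C\<^sup>2)\<close>, where \<open>v\<close> is the unit major
  direction and \<open>A \<ge> C\<close> are the semi-axes (\<open>B_tri_chart\<close>). As \<open>B\<close> is nonzero, \<open>v\<close> itself can
  serve as \<open>u\<close>.

  Conversely, the image of an equilateral triangle with circumradius 2 has the ellipse as its
  Siebeck-Marden ellipse, and the discrete Fourier transform of the three vertices presents every
  noncollinear triangle as such an image (\<open>siebeck_marden_exists\<close>).
\<close>

section \<open>Critical points of the curvature\<close>

definition curvature_denom :: "complex \<Rightarrow> complex \<Rightarrow> real" where
  "curvature_denom B w = 1 / 9 + (norm (w\<^sup>2 - B))\<^sup>2"

lemma curvature_denom_pos: "curvature_denom B w > 0"
  by (simp add: curvature_denom_def add_pos_nonneg)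

text \<open>Up to a nonzero factor this is the gradient of the curvature at \<open>b + w\<close>, read as a complex
  number: the directional derivative along \<open>v\<close> is a multiple of its real inner product with \<open>v\<close>.\<close>

definition gradient_factor :: "complex \<Rightarrow> complex \<Rightarrow> complex" where
  "gradient_factor B w =
     of_real (curvature_denom B w) * w - 6 * of_real ((norm w)\<^sup>2) * (w\<^sup>2 - B) * cnj w"

lemma norm_square_line_deriv:
  fixes f :: "complex \<Rightarrow> complex"
  assumes "(f has_field_derivative d) (at z)"
  shows "((\<lambda>t. (norm (f (z + t *\<^sub>R v)))\<^sup>2) has_real_derivative 2 * (f z \<bullet> (d * v))) (at 0)"
proof -
  have "((\<lambda>t. f (z + t *\<^sub>R v) \<bullet> f (z + t *\<^sub>R v)) has_vector_derivative
     (f (z + 0 *\<^sub>R v) \<bullet> (d * v) + (d * v) \<bullet> f (z + 0 *\<^sub>R v))) (at (0::real))"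
    by (intro bounded_bilinear.has_vector_derivative[OF bounded_bilinear_inner] line_deriv assms)
  then show ?thesis
    by (simp add: power2_norm_eq_inner has_real_derivative_iff_has_vector_derivative inner_commute)
qed

lemma curvature_line_deriv:
  fixes a b c z v :: complex
  defines "w \<equiv> z - barycenter a b c" and "B \<equiv> B_tri a b c"
  shows "((\<lambda>t. graph_curvature (cubic a b c) (z + t *\<^sub>R v)) has_real_derivative
    - (16 / 81) * (gradient_factor B w \<bullet> v) / curvature_denom B w ^ 4) (at 0)"
proof -
  let ?m = "barycenter a b c"
  let ?D = "curvature_denom B w"
  have dN: "((\<lambda>t. (norm (z + t *\<^sub>R v - ?m))\<^sup>2) has_real_derivative 2 * (w \<bullet> (1 * v))) (at 0)"
    unfolding w_def
    by (rule norm_square_line_deriv[where f = "\<lambda>z. z - ?m"]) (auto intro!: derivative_eq_intros)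
  have "((\<lambda>t. (norm ((z + t *\<^sub>R v - ?m)\<^sup>2 - B))\<^sup>2) has_real_derivative
      2 * ((w\<^sup>2 - B) \<bullet> ((2 * w) * v))) (at 0)"
    unfolding w_def
    by (rule norm_square_line_deriv[where f = "\<lambda>z. (z - ?m)\<^sup>2 - B"])
      (auto intro!: derivative_eq_intros)
  from DERIV_add[OF DERIV_const[of "1 / 9"] this]
  have dD: "((\<lambda>t. curvature_denom B (z + t *\<^sub>R v - ?m)) has_real_derivative
      2 * ((w\<^sup>2 - B) \<bullet> ((2 * w) * v))) (at 0)"
    unfolding curvature_denom_def by simp
  have D0: "?D \<noteq> 0" using curvature_denom_pos[of B w] by simp
  (* Multiplication by w has the adjoint multiplication by cnj w, which isolates v. *)
  have adj: "(w\<^sup>2 - B) \<bullet> ((2 * w) * v) = 2 * (((w\<^sup>2 - B) * cnj w) \<bullet> v)"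
    by (simp add: inner_complex_def algebra_simps)
  have G: "gradient_factor B w \<bullet> v = ?D * (w \<bullet> v) - 6 * (norm w)\<^sup>2 * (((w\<^sup>2 - B) * cnj w) \<bullet> v)"
    unfolding gradient_factor_def by (simp add: inner_complex_def algebra_simps)
  have "((\<lambda>t. (norm (z + t *\<^sub>R v - ?m))\<^sup>2 / curvature_denom B (z + t *\<^sub>R v - ?m) ^ 3)
      has_real_derivative 2 * (gradient_factor B w \<bullet> v) / ?D ^ 4) (at 0)"
    apply (rule DERIV_cong[OF DERIV_divide[OF dN DERIV_power[OF dD]]])
    using D0 apply (simp add: w_def)
    unfolding G adj using D0 unfolding w_def[symmetric]
    by (simp add: w_def[symmetric] field_simps power2_eq_square power3_eq_cube power4_eq_xxxx)
  from DERIV_cmult[OF this, of "-(8/81)"] show ?thesis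
    unfolding graph_curvature_cubic curvature_denom_def B_def by simp
qed

lemma critical_points_curvature_eq:
  "critical_points (graph_curvature (cubic a b c)) =
     {z. gradient_factor (B_tri a b c) (z - barycenter a b c) = 0}"
proof -
  have "(\<forall>i. ((\<lambda>t. graph_curvature (cubic a b c) (z + t *\<^sub>R frame i)) has_real_derivative 0) (at 0))
     \<longleftrightarrow> gradient_factor (B_tri a b c) (z - barycenter a b c) = 0" (is "?L \<longleftrightarrow> ?g = 0") for z
  proof -
    have "?L \<longleftrightarrow> (\<forall>i::2. ?g \<bullet> frame i = 0)"
    proof (intro iff_allI)
      fix i :: 2
      show "((\<lambda>t. graph_curvature (cubic a b c) (z + t *\<^sub>R frame i)) has_real_derivative 0) (at 0)
        \<longleftrightarrow> ?g \<bullet> frame i = 0"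
        using curvature_line_deriv[of a b c z "frame i"]
          curvature_denom_pos[of "B_tri a b c" "z - barycenter a b c"] DERIV_unique
        by fastforce
    qed
    also have "\<dots> \<longleftrightarrow> ?g = 0"
      by (simp add: forall_2 frame_def inner_complex_def complex_eq_iff)
    finally show ?thesis .
  qed
  then show ?thesis unfolding critical_points_def by blast
qed

text \<open>As a quadratic in \<open>y\<^sup>2\<close> the left-hand side has negative constant term, so its two roots have
  opposite signs and only the positive one is a square.\<close>

lemma biquadratic_unique_pos_root:
  fixes p k :: real
  assumes "k > 0"
  shows "\<exists>x>0. \<forall>y. 5 * y ^ 4 - 4 * p * y\<^sup>2 - k = 0 \<longleftrightarrow> y = x \<or> y = - x"
proof -
  define d where "d = sqrt (4 * p\<^sup>2 + 5 * k)"
  define s where "s = (2 * p + d) / 5"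
  have d2: "d\<^sup>2 = 4 * p\<^sup>2 + 5 * k" unfolding d_def using assms by simp
  have "d > \<bar>2 * p\<bar>"
    unfolding d_def using assms by (intro real_less_rsqrt) (simp add: power2_eq_square)
  then have s: "s > 0" and s': "(2 * p - d) / 5 < 0" by (auto simp: s_def)
  have "5 * y ^ 4 - 4 * p * y\<^sup>2 - k = 0 \<longleftrightarrow> y = sqrt s \<or> y = - sqrt s" for y :: real
  proof -
    have "5 * y ^ 4 - 4 * p * y\<^sup>2 - k = 5 * (y\<^sup>2 - s) * (y\<^sup>2 - (2 * p - d) / 5)"
      using d2 unfolding s_def by (simp add: field_simps power2_eq_square power4_eq_xxxx)
    moreover have "y\<^sup>2 - (2 * p - d) / 5 > 0" using s' zero_le_power2[of y] by linarith
    ultimately have "5 * y ^ 4 - 4 * p * y\<^sup>2 - k = 0 \<longleftrightarrow> y\<^sup>2 = (sqrt s)\<^sup>2"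
      using s by simp
    then show ?thesis by (simp add: power2_eq_iff del: real_sqrt_pow2_iff)
  qed
  then show ?thesis using s by (intro exI[of _ "sqrt s"]) simp
qed

text \<open>In the frame \<open>u, i u\<close> the reflections in both axes are symmetries of the curvature, which is why
  the components are divisible by \<open>x\<close> and \<open>y\<close> respectively.\<close>

lemma gradient_factor_rotated:
  fixes u :: complex and x y \<beta> :: real
  assumes "norm u = 1"
  shows "gradient_factor (u\<^sup>2 * of_real \<beta>) (u * Complex x y) =
    u * Complex (x * (1 / 9 + \<beta>\<^sup>2 + (x\<^sup>2 + y\<^sup>2)\<^sup>2 - 2 * \<beta> * (x\<^sup>2 - y\<^sup>2) - 6 * (x\<^sup>2 + y\<^sup>2) * (x\<^sup>2 + y\<^sup>2 - \<beta>)))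
                (y * (1 / 9 + \<beta>\<^sup>2 + (x\<^sup>2 + y\<^sup>2)\<^sup>2 - 2 * \<beta> * (x\<^sup>2 - y\<^sup>2) - 6 * (x\<^sup>2 + y\<^sup>2) * (x\<^sup>2 + y\<^sup>2 + \<beta>)))"
proof -
  have uc: "u * cnj u = 1" using assms by (simp add: complex_norm_square[symmetric])
  have sq: "(u * Complex x y)\<^sup>2 - u\<^sup>2 * of_real \<beta> = u\<^sup>2 * Complex (x\<^sup>2 - y\<^sup>2 - \<beta>) (2 * x * y)"
  proof -
    have "(Complex x y)\<^sup>2 - of_real \<beta> = Complex (x\<^sup>2 - y\<^sup>2 - \<beta>) (2 * x * y)"
      by (simp add: complex_eq_iff power2_eq_square)
    moreover have "(u * Complex x y)\<^sup>2 - u\<^sup>2 * of_real \<beta> = u\<^sup>2 * ((Complex x y)\<^sup>2 - of_real \<beta>)"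
      by (simp add: power_mult_distrib right_diff_distrib)
    ultimately show ?thesis by simp
  qed
  have D: "curvature_denom (u\<^sup>2 * of_real \<beta>) (u * Complex x y)
      = 1 / 9 + \<beta>\<^sup>2 + (x\<^sup>2 + y\<^sup>2)\<^sup>2 - 2 * \<beta> * (x\<^sup>2 - y\<^sup>2)"
    unfolding curvature_denom_def sq using assms
    by (simp add: norm_mult norm_power cmod_power2) (simp add: power2_eq_square algebra_simps)
  have N: "(norm (u * Complex x y))\<^sup>2 = x\<^sup>2 + y\<^sup>2"
    using assms by (simp add: norm_mult cmod_power2)
  have "u\<^sup>2 * Complex (x\<^sup>2 - y\<^sup>2 - \<beta>) (2 * x * y) * cnj (u * Complex x y)
      = (u * cnj u) * u * (Complex (x\<^sup>2 - y\<^sup>2 - \<beta>) (2 * x * y) * cnj (Complex x y))"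
    by (simp add: power2_eq_square)
  also have "\<dots> = u * Complex (x * (x\<^sup>2 + y\<^sup>2 - \<beta>)) (y * (x\<^sup>2 + y\<^sup>2 + \<beta>))"
    unfolding uc by (simp add: complex_eq_iff power2_eq_square algebra_simps)
  finally have R: "u\<^sup>2 * Complex (x\<^sup>2 - y\<^sup>2 - \<beta>) (2 * x * y) * cnj (u * Complex x y)
      = u * Complex (x * (x\<^sup>2 + y\<^sup>2 - \<beta>)) (y * (x\<^sup>2 + y\<^sup>2 + \<beta>))" .
  have comb: "of_real d * (u * Complex x y) - 6 * of_real n * (u * Complex (x * p) (y * q))
      = u * Complex (x * (d - 6 * n * p)) (y * (d - 6 * n * q))" for d n p q :: real
  proof -
    have "Complex (x * (d - 6 * n * p)) (y * (d - 6 * n * q))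
        = of_real d * Complex x y - 6 * of_real n * Complex (x * p) (y * q)"
      by (simp add: complex_eq_iff algebra_simps)
    then show ?thesis by (simp add: right_diff_distrib mult.left_commute)
  qed
  show ?thesis
    unfolding gradient_factor_def D N sq mult.assoc[of "6 * _"] R comb ..
qed

lemma gradient_factor_zeros:
  fixes u :: complex and \<beta> :: real
  assumes u: "norm u = 1" and \<beta>: "\<beta> > 0"
  shows "\<exists>x>0. \<exists>y>0. {w. gradient_factor (u\<^sup>2 * of_real \<beta>) w = 0} =
    (\<lambda>\<xi>. u * \<xi>) ` {0, Complex x 0, Complex (-x) 0, Complex 0 y, Complex 0 (-y)}"
proof -
  define k where "k = 1 / 9 + \<beta>\<^sup>2"
  have k: "k > 0" by (simp add: k_def add_pos_nonneg)
  obtain x where x: "x > 0" "\<And>s. 5 * s ^ 4 - 4 * \<beta> * s\<^sup>2 - k = 0 \<longleftrightarrow> s = x \<or> s = - x"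
    using biquadratic_unique_pos_root[OF k, of \<beta>] by blast
  obtain y where y: "y > 0" "\<And>s. 5 * s ^ 4 - 4 * (-\<beta>) * s\<^sup>2 - k = 0 \<longleftrightarrow> s = y \<or> s = - y"
    using biquadratic_unique_pos_root[OF k, of "-\<beta>"] by blast
  have u0: "u \<noteq> 0" using u by auto
  have zeros: "gradient_factor (u\<^sup>2 * of_real \<beta>) (u * Complex s t) = 0 \<longleftrightarrow>
      (s = 0 \<and> t = 0) \<or> ((s = x \<or> s = -x) \<and> t = 0) \<or> (s = 0 \<and> (t = y \<or> t = -y))" for s t
  proof -
    define P where "P = k + (s\<^sup>2 + t\<^sup>2)\<^sup>2 - 2 * \<beta> * (s\<^sup>2 - t\<^sup>2)"
    have "gradient_factor (u\<^sup>2 * of_real \<beta>) (u * Complex s t) = 0 \<longleftrightarrow>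
       s * (P - 6 * (s\<^sup>2 + t\<^sup>2) * (s\<^sup>2 + t\<^sup>2 - \<beta>)) = 0 \<and> t * (P - 6 * (s\<^sup>2 + t\<^sup>2) * (s\<^sup>2 + t\<^sup>2 + \<beta>)) = 0"
      unfolding gradient_factor_rotated[OF u] P_def k_def
      using u0 by (simp only: mult_eq_0_iff[of u] Complex_eq_0 simp_thms)
    also have "\<dots> \<longleftrightarrow> (s = 0 \<and> t = 0)
        \<or> (t = 0 \<and> s \<noteq> 0 \<and> 5 * s ^ 4 - 4 * \<beta> * s\<^sup>2 - k = 0)
        \<or> (s = 0 \<and> t \<noteq> 0 \<and> 5 * t ^ 4 - 4 * (-\<beta>) * t\<^sup>2 - k = 0)"
    proof (cases "s = 0 \<or> t = 0")
      case True
      have "P - 6 * (s\<^sup>2 + t\<^sup>2) * (s\<^sup>2 + t\<^sup>2 - \<beta>) = - (5 * s ^ 4 - 4 * \<beta> * s\<^sup>2 - k)" if "t = 0"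
        unfolding P_def that by (simp add: power2_eq_square power4_eq_xxxx algebra_simps)
      moreover have "P - 6 * (s\<^sup>2 + t\<^sup>2) * (s\<^sup>2 + t\<^sup>2 + \<beta>) = - (5 * t ^ 4 - 4 * (-\<beta>) * t\<^sup>2 - k)"
        if "s = 0"
        unfolding P_def that by (simp add: power2_eq_square power4_eq_xxxx algebra_simps)
      ultimately show ?thesis
        using True by (metis mult_eq_0_iff neg_equal_0_iff_equal)
    next
      case False
      (* Off the axes both brackets would have to vanish, and they differ by 12 \<beta> (s^2 + t^2). *)
      have "\<beta> * (s\<^sup>2 + t\<^sup>2) > 0" using False \<beta> by (simp add: sum_power2_gt_zero_iff)
      then have "P - 6 * (s\<^sup>2 + t\<^sup>2) * (s\<^sup>2 + t\<^sup>2 - \<beta>) \<noteq> P - 6 * (s\<^sup>2 + t\<^sup>2) * (s\<^sup>2 + t\<^sup>2 + \<beta>)"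
        by (simp add: algebra_simps)
      then show ?thesis using False by auto
    qed
    also have "\<dots> \<longleftrightarrow> (s = 0 \<and> t = 0) \<or> ((s = x \<or> s = -x) \<and> t = 0) \<or> (s = 0 \<and> (t = y \<or> t = -y))"
      unfolding x(2) y(2) using x(1) y(1) by auto
    finally show ?thesis .
  qed
  have "gradient_factor (u\<^sup>2 * of_real \<beta>) (u * \<xi>) = 0 \<longleftrightarrow>
      \<xi> \<in> {0, Complex x 0, Complex (-x) 0, Complex 0 y, Complex 0 (-y)}" for \<xi>
    using zeros[of "Re \<xi>" "Im \<xi>"] by (auto simp: complex_eq_iff)
  moreover have "{w. gradient_factor (u\<^sup>2 * of_real \<beta>) w = 0} =
      (\<lambda>\<xi>. u * \<xi>) ` {\<xi>. gradient_factor (u\<^sup>2 * of_real \<beta>) (u * \<xi>) = 0}"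
  proof (intro set_eqI iffI)
    fix w assume "w \<in> {w. gradient_factor (u\<^sup>2 * of_real \<beta>) w = 0}"
    moreover have "w = u * (w / u)" using u0 by simp
    ultimately show "w \<in> (\<lambda>\<xi>. u * \<xi>) ` {\<xi>. gradient_factor (u\<^sup>2 * of_real \<beta>) (u * \<xi>) = 0}"
      by (intro image_eqI[of _ _ "w / u"]) simp_all
  qed auto
  ultimately have "{w. gradient_factor (u\<^sup>2 * of_real \<beta>) w = 0} =
    (\<lambda>\<xi>. u * \<xi>) ` {0, Complex x 0, Complex (-x) 0, Complex 0 y, Complex 0 (-y)}"
    by (simp only: Collect_mem_eq)
  then show ?thesis using x(1) y(1) by blast
qed

text \<open>The unit \<open>u\<close> is left as a parameter, determined by \<open>B\<close> only up to sign: a square root of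
  \<open>B / |B|\<close> is used for counting, and the major direction of a given ellipse for locating.\<close>

lemma critical_points_on_axes:
  fixes a b c u :: complex and \<beta> :: real
  assumes u: "norm u = 1" and \<beta>: "\<beta> > 0" and B: "B_tri a b c = u\<^sup>2 * of_real \<beta>"
  obtains x y where "x > 0" "y > 0"
    "critical_points (graph_curvature (cubic a b c)) =
      (\<lambda>\<xi>. barycenter a b c + u * \<xi>) ` {0, Complex x 0, Complex (-x) 0, Complex 0 y, Complex 0 (-y)}"
proof -
  obtain x y where xy: "x > 0" "y > 0" and Z: "{w. gradient_factor (B_tri a b c) w = 0} =
    (\<lambda>\<xi>. u * \<xi>) ` {0, Complex x 0, Complex (-x) 0, Complex 0 y, Complex 0 (-y)}"
    using gradient_factor_zeros[OF u \<beta>] unfolding B by blast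
  have "critical_points (graph_curvature (cubic a b c)) =
      (\<lambda>w. barycenter a b c + w) ` {w. gradient_factor (B_tri a b c) w = 0}"
    unfolding critical_points_curvature_eq by (force simp: image_iff)
  then show ?thesis using that[OF xy] unfolding Z image_image by blast
qed

lemma card_critical_points:
  assumes "B_tri a b c \<noteq> 0"
  shows "card (critical_points (graph_curvature (cubic a b c))) = 5"
proof -
  define \<beta> where "\<beta> = norm (B_tri a b c)"
  define u where "u = csqrt (sgn (B_tri a b c))"
  have u2: "u\<^sup>2 = sgn (B_tri a b c)" by (simp add: u_def)
  then have "(norm u)\<^sup>2 = 1" using assms by (simp add: norm_power[symmetric] norm_sgn)
  then have u: "norm u = 1" using norm_ge_zero[of u] by (auto simp: power2_eq_1_iff)
  have B: "B_tri a b c = u\<^sup>2 * of_real \<beta>" using assms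
    by (simp add: u2 \<beta>_def sgn_div_norm scaleR_conv_of_real field_simps)
  have \<beta>: "\<beta> > 0" using assms by (simp add: \<beta>_def)
  obtain x y where xy: "x > 0" "y > 0" and C: "critical_points (graph_curvature (cubic a b c)) =
      (\<lambda>\<xi>. barycenter a b c + u * \<xi>) ` {0, Complex x 0, Complex (-x) 0, Complex 0 y, Complex 0 (-y)}"
    by (rule critical_points_on_axes[OF u \<beta> B])
  have "inj (\<lambda>\<xi>. barycenter a b c + u * \<xi>)" using u by (auto intro!: injI)
  then have "card (critical_points (graph_curvature (cubic a b c))) =
     card {0, Complex x 0, Complex (-x) 0, Complex 0 y, Complex 0 (-y)}"
    unfolding C by (rule card_image[OF inj_on_subset]) simp
  also have "\<dots> = 5" using xy by (simp add: complex_eq_iff)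
  finally show ?thesis .
qed


section \<open>An ellipse as the affine image of the unit circle\<close>

definition chart :: "ellipse \<Rightarrow> complex \<Rightarrow> complex" where
  "chart E w = center E + major_dir E * Complex (semi_major E * Re w) (semi_minor E * Im w)"

lemma chart_cis: "chart E (cis t) = ellipse_path E t"
  by (simp add: chart_def ellipse_path_def complex_eq_iff algebra_simps)

lemma chart_affine: "chart E (w + s *\<^sub>R d) = chart E w + s *\<^sub>R (chart E d - center E)"
  by (simp add: chart_def complex_eq_iff algebra_simps)

lemma chart_convex_combination:
  "x + y + z = 1 \<Longrightarrow>
    chart E (x *\<^sub>R p + y *\<^sub>R q + z *\<^sub>R r) = x *\<^sub>R chart E p + y *\<^sub>R chart E q + z *\<^sub>R chart E r"
proof -
  assume "x + y + z = 1"
  then have z: "z = 1 - x - y" by simp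
  show ?thesis unfolding z by (simp add: chart_def complex_eq_iff algebra_simps)
qed

lemma chart_midpoint: "chart E (midpoint p q) = midpoint (chart E p) (chart E q)"
  by (simp add: midpoint_def chart_def complex_eq_iff field_simps)

lemma chart_inj:
  assumes "is_ellipse E" "chart E p = chart E q"
  shows "p = q"
proof -
  have "major_dir E \<noteq> 0" "semi_major E \<noteq> 0" "semi_minor E \<noteq> 0"
    using assms(1) by (auto simp: is_ellipse_def)
  then show ?thesis using assms(2) by (auto simp: chart_def intro: complex_eqI)
qed

lemma chart_surj:
  assumes "is_ellipse E"
  obtains w where "chart E w = z"
proof -
  have n: "major_dir E \<noteq> 0" "semi_major E \<noteq> 0" "semi_minor E \<noteq> 0"
    using assms by (auto simp: is_ellipse_def)
  define y where "y = (z - center E) / major_dir E"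
  have "chart E (Complex (Re y / semi_major E) (Im y / semi_minor E)) = center E + major_dir E * y"
    using n by (simp add: chart_def)
  then show ?thesis using that n by (simp add: y_def)
qed

text \<open>Affine maps carry tangent lines to tangent lines, so tangency to the ellipse becomes tangency to
  the unit circle, where the tangent at \<open>p\<close> has direction \<open>i p\<close>.\<close>

lemma tangent_line_chart:
  "tangent_line_at E t = range (\<lambda>s. chart E (cis t + s *\<^sub>R (\<i> * cis t)))"
proof -
  have "(ellipse_path E has_vector_derivative chart E (\<i> * cis t) - center E) (at t)"
    unfolding ellipse_path_def[abs_def] has_vector_derivative_def
    by (auto intro!: derivative_eq_intros
        simp: chart_def complex_eq_iff algebra_simps)
  then show ?thesis
    unfolding tangent_line_at_def chart_affine by (simp add: vector_derivative_at chart_cis)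
qed

text \<open>A segment that touches the unit circle at its midpoint is perpendicular to the radius there, so its
  ends are equidistant from the origin; its midpoint has modulus 1.\<close>

lemma tangent_to_side_at_midpointD:
  assumes E: "is_ellipse E" and tan: "tangent_to_side_at_midpoint E (chart E p) (chart E q)"
  shows "norm p = norm q \<and> norm (p + q) = 2"
proof -
  obtain t where t: "chart E (cis t) = chart E (midpoint p q)"
      "tangent_line_at E t = affine hull {chart E p, chart E q}"
    using tan unfolding tangent_to_side_at_midpoint_def chart_cis chart_midpoint by blast
  have mid: "cis t = midpoint p q" using chart_inj[OF E t(1)] .
  have "chart E p \<in> tangent_line_at E t" unfolding t(2) by (simp add: hull_inc)
  then obtain s where "chart E p = chart E (cis t + s *\<^sub>R (\<i> * cis t))"
    unfolding tangent_line_chart by blast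
  then have p: "p = cis t + s *\<^sub>R (\<i> * cis t)" by (rule chart_inj[OF E])
  have q: "q = cis t - s *\<^sub>R (\<i> * cis t)"
    using mid p by (simp add: midpoint_def scaleR_conv_of_real field_simps)
  have pq: "p = Complex 1 s * cis t" "q = Complex 1 (-s) * cis t"
    unfolding p q by (simp_all add: complex_eq_iff)
  have "norm p = norm q" unfolding pq norm_mult by (simp add: cmod_def)
  moreover have "p + q = 2 * cis t" by (simp add: p q)
  ultimately show ?thesis by (simp add: norm_mult)
qed

section \<open>The Siebeck-Marden ellipse is the image of the incircle\<close>

text \<open>The three vertices are equidistant from the origin, and so are the three side midpoints. Hence the
  pairwise inner products agree, and the sum of the vertices is perpendicular to every side. The
  sides are not all parallel, so the sum is zero; then \<open>r = - (p + q)\<close> has modulus 2.\<close>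

lemma siebeck_marden_chart_equilateral:
  assumes S: "siebeck_marden_ellipse (chart E p) (chart E q) (chart E r) E"
    and nc: "\<not> collinear {chart E p, chart E q, chart E r}"
  shows "p + q + r = 0 \<and> norm p = 2 \<and> norm q = 2 \<and> norm r = 2"
proof -
  have E: "is_ellipse E" using S by (simp add: siebeck_marden_ellipse_def)
  have pq: "norm p = norm q \<and> norm (p + q) = 2" and qr: "norm q = norm r \<and> norm (q + r) = 2"
    and rp: "norm r = norm p \<and> norm (r + p) = 2"
    using S tangent_to_side_at_midpointD[OF E] unfolding siebeck_marden_ellipse_def by blast+
  define g where "g = p + q + r"
  have e: "p \<bullet> p = q \<bullet> q" "q \<bullet> q = r \<bullet> r" using pq qr by (simp_all add: norm_eq)
  have f: "(p + q) \<bullet> (p + q) = 4" "(q + r) \<bullet> (q + r) = 4" "(r + p) \<bullet> (r + p) = 4"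
    using pq qr rp by (simp_all add: power2_norm_eq_inner[symmetric])
  have perp: "g \<bullet> (p - q) = 0" "g \<bullet> (p - r) = 0"
    using e f unfolding g_def by (auto simp: inner_simps inner_commute)
  have "g = 0"
  proof (rule ccontr)
    assume g: "g \<noteq> 0"
    have par: "\<exists>s. d = s *\<^sub>R (\<i> * g)" if "g \<bullet> d = 0" for d
    proof -
      have "Re (d * cnj g) = 0" using that by (simp add: inner_complex_def algebra_simps)
      then have "d * cnj g = \<i> * of_real (Im (d * cnj g))" by (simp add: complex_eq_iff)
      then have "d * (cnj g * g) = of_real (Im (d * cnj g)) * (\<i> * g)" by (simp add: ac_simps)
      also have "cnj g * g = of_real ((norm g)\<^sup>2)" by (simp add: complex_norm_square[symmetric] mult.commute)
      finally have "d = (Im (d * cnj g) / (norm g)\<^sup>2) *\<^sub>R (\<i> * g)"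
        using g by (simp add: scaleR_conv_of_real field_simps)
      then show ?thesis by blast
    qed
    obtain s s' where s: "p - q = s *\<^sub>R (\<i> * g)" and s': "p - r = s' *\<^sub>R (\<i> * g)"
      using par perp by blast
    define v where "v = chart E (\<i> * g) - center E"
    have "q = p + (-s) *\<^sub>R (\<i> * g)" "r = p + (-s') *\<^sub>R (\<i> * g)"
      unfolding scaleR_minus_left s[symmetric] s'[symmetric] by simp_all
    then have "chart E q = chart E p + (-s) *\<^sub>R v" "chart E r = chart E p + (-s') *\<^sub>R v"
      unfolding v_def by (metis chart_affine)+
    moreover have "chart E p = chart E p + 0 *\<^sub>R v" by simp
    ultimately have "collinear {chart E p, chart E q, chart E r}"
      unfolding collinear_alt by blast
    with nc show False ..
  qed
  then have sum: "p + q + r = 0" by (simp only: g_def)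
  then have "norm r = norm (p + q)"
    by (metis add_eq_0_iff norm_minus_cancel)
  then have "norm r = 2" using pq by (simp only:)
  then show ?thesis using sum pq rp by metis
qed

text \<open>On the circle of radius 2 the conjugate of \<open>p\<close> is \<open>4 / p\<close>, so the conjugate of the first
  elementary symmetric function is proportional to the second one, and both vanish.\<close>

lemma equilateral_sum_squares:
  fixes p q r :: complex
  assumes sum: "p + q + r = 0" and n: "norm p = 2" "norm q = 2" "norm r = 2"
  shows "p\<^sup>2 + q\<^sup>2 + r\<^sup>2 = 0"
proof -
  have c: "p * cnj p = 4" "q * cnj q = 4" "r * cnj r = 4"
    using n by (simp_all add: complex_norm_square[symmetric])
  have "4 * (q * r + p * r + p * q) = p * q * r * cnj (p + q + r)"
  proof -
    have "p * q * r * cnj (p + q + r) = (p * cnj p) * (q * r) + (q * cnj q) * (p * r) + (r * cnj r) * (p * q)"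
      by (simp add: algebra_simps)
    then show ?thesis unfolding c by (simp add: algebra_simps)
  qed
  then have "4 * (q * r + p * r + p * q) = 0" by (simp only: sum complex_cnj_zero mult_zero_right)
  then have "q * r + p * r + p * q = 0" by (simp only: mult_eq_0_iff zero_neq_numeral[symmetric] simp_thms)
  moreover have "p\<^sup>2 + q\<^sup>2 + r\<^sup>2 = (p + q + r)\<^sup>2 - 2 * (q * r + p * r + p * q)"
    by (simp add: power2_eq_square algebra_simps)
  ultimately show ?thesis by (simp add: sum)
qed

text \<open>The holomorphic and antiholomorphic parts of the chart; products of such expressions are easier to
  expand than real and imaginary parts.\<close>

lemma chart_cnj:
  "chart E w = center E + major_dir E *
     (of_real ((semi_major E + semi_minor E) / 2) * w + of_real ((semi_major E - semi_minor E) / 2) * cnj w)"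
  by (simp add: chart_def complex_eq_iff field_simps)

lemma barycenter_chart:
  assumes "p + q + r = 0"
  shows "barycenter (chart E p) (chart E q) (chart E r) = center E"
proof -
  have r: "r = - p - q" using assms by (simp add: algebra_simps eq_neg_iff_add_eq_0)
  show ?thesis unfolding r by (simp add: barycenter_def chart_cnj field_simps)
qed

lemma B_tri_centered:
  assumes "a + b + c = 3 * m"
  shows "6 * B_tri a b c = (a - m)\<^sup>2 + (b - m)\<^sup>2 + (c - m)\<^sup>2"
proof -
  have c: "c = 3 * m - a - b" using assms by (simp add: algebra_simps)
  show ?thesis unfolding c by (simp add: B_tri_def barycenter_def power2_eq_square field_simps)
qed

text \<open>Let \<open>A\<close> and \<open>C\<close> be half the sum and half the difference of the semi-axes. Squaring
  \<open>A p + C \<cdot> cnj p\<close> and adding over the vertices kills both pure squares, and only the mixed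
  terms \<open>2 A C |p|\<^sup>2\<close> survive. Geometrically, the right-hand side is the square of the displacement from
  the center to a focus, in accordance with the Siebeck-Marden theorem.\<close>

lemma B_tri_chart:
  assumes sum: "p + q + r = 0" and n: "norm p = 2" "norm q = 2" "norm r = 2"
  shows "B_tri (chart E p) (chart E q) (chart E r) =
    (major_dir E)\<^sup>2 * of_real ((semi_major E)\<^sup>2 - (semi_minor E)\<^sup>2)"
proof -
  define A C :: complex where "A = of_real ((semi_major E + semi_minor E) / 2)"
    and "C = of_real ((semi_major E - semi_minor E) / 2)"
  have c: "p * cnj p = 4" "q * cnj q = 4" "r * cnj r = 4"
    using n by (simp_all add: complex_norm_square[symmetric])
  have off: "chart E z - center E = major_dir E * (A * z + C * cnj z)" for z
    unfolding chart_cnj A_def C_def by simp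
  have sq: "p\<^sup>2 + q\<^sup>2 + r\<^sup>2 = 0" using equilateral_sum_squares[OF assms] .
  have sq': "(cnj p)\<^sup>2 + (cnj q)\<^sup>2 + (cnj r)\<^sup>2 = 0" using arg_cong[OF sq, of cnj] by simp
  have "chart E p + chart E q + chart E r = 3 * center E"
    using barycenter_chart[OF sum, of E] by (simp add: barycenter_def field_simps)
  then have "6 * B_tri (chart E p) (chart E q) (chart E r) =
      (chart E p - center E)\<^sup>2 + (chart E q - center E)\<^sup>2 + (chart E r - center E)\<^sup>2"
    by (rule B_tri_centered)
  also have "\<dots> = (major_dir E)\<^sup>2 * ((A * p + C * cnj p)\<^sup>2 + (A * q + C * cnj q)\<^sup>2 + (A * r + C * cnj r)\<^sup>2)"
    by (simp only: off power_mult_distrib distrib_left[of "(major_dir E)\<^sup>2"])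
  also have "(A * p + C * cnj p)\<^sup>2 + (A * q + C * cnj q)\<^sup>2 + (A * r + C * cnj r)\<^sup>2
      = A\<^sup>2 * (p\<^sup>2 + q\<^sup>2 + r\<^sup>2) + C\<^sup>2 * ((cnj p)\<^sup>2 + (cnj q)\<^sup>2 + (cnj r)\<^sup>2)
        + 2 * A * C * (p * cnj p + q * cnj q + r * cnj r)"
    by (simp add: power2_eq_square algebra_simps)
  also have "\<dots> = 24 * (A * C)" unfolding sq sq' c by simp
  also have "A * C = of_real (((semi_major E)\<^sup>2 - (semi_minor E)\<^sup>2) / 4)"
    unfolding A_def C_def of_real_mult[symmetric] by (simp add: power2_eq_square field_simps)
  also have "(major_dir E)\<^sup>2 * (24 * complex_of_real (((semi_major E)\<^sup>2 - (semi_minor E)\<^sup>2) / 4)) =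
      6 * ((major_dir E)\<^sup>2 * of_real ((semi_major E)\<^sup>2 - (semi_minor E)\<^sup>2))" by simp
  finally show ?thesis by (metis mult_cancel_left zero_neq_numeral)
qed

lemma siebeck_marden_center_and_B:
  assumes nc: "\<not> collinear {a, b, c}" and S: "siebeck_marden_ellipse a b c E"
  shows "center E = barycenter a b c"
    and "B_tri a b c = (major_dir E)\<^sup>2 * of_real ((semi_major E)\<^sup>2 - (semi_minor E)\<^sup>2)"
proof -
  have E: "is_ellipse E" using S by (simp add: siebeck_marden_ellipse_def)
  obtain p where p: "chart E p = a" by (rule chart_surj[OF E])
  obtain q where q: "chart E q = b" by (rule chart_surj[OF E])
  obtain r where r: "chart E r = c" by (rule chart_surj[OF E])
  have eq: "p + q + r = 0" "norm p = 2" "norm q = 2" "norm r = 2"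
    using siebeck_marden_chart_equilateral[of E p q r] S nc unfolding p q r by auto
  show "center E = barycenter a b c"
    using barycenter_chart[OF eq(1), of E] unfolding p q r by simp
  show "B_tri a b c = (major_dir E)\<^sup>2 * of_real ((semi_major E)\<^sup>2 - (semi_minor E)\<^sup>2)"
    using B_tri_chart[OF eq, of E] unfolding p q r .
qed


section \<open>Existence of the Siebeck-Marden ellipse\<close>

lemma equilateral_tangent_to_side:
  assumes sum: "p + q + r = 0" and n: "norm p = 2" "norm q = 2" "norm r = 2"
  shows "tangent_to_side_at_midpoint E (chart E p) (chart E q)"
proof -
  define m where "m = midpoint p q"
  have pq: "p + q = - r" using sum by (simp add: add_eq_0_iff2 add.commute)
  have "norm (p + q) = 2" unfolding pq using n by simp
  then have "norm m = 1" by (simp add: m_def midpoint_def)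
  then have "m = cis (Arg m)" using cis_Arg[of m] by (force simp: sgn_div_norm)
  then obtain t where t: "m = cis t" by blast
  define s where "s = Im ((p - q) / 2 * cnj m)"
  have pp: "p \<bullet> p = 4" "q \<bullet> q = 4" using n by (simp_all add: power2_norm_eq_inner[symmetric])
  have mm: "cnj m * m = 1" using \<open>norm m = 1\<close> by (simp add: complex_norm_square[symmetric] mult.commute)
  have "Re ((p - q) / 2 * cnj m) = ((p - q) \<bullet> (p + q)) / 4"
    by (simp add: m_def midpoint_def inner_complex_def field_simps)
  also have "\<dots> = 0" using pp by (simp add: inner_simps inner_commute)
  finally have "(p - q) / 2 * cnj m = \<i> * of_real s" unfolding s_def by (simp add: complex_eq_iff)
  then have "(p - q) / 2 * (cnj m * m) = \<i> * of_real s * m" by (simp add: mult.assoc[symmetric])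
  then have half: "(p - q) / 2 = s *\<^sub>R (\<i> * m)" unfolding mm by (simp add: scaleR_conv_of_real mult_ac)
  have p: "p = m + s *\<^sub>R (\<i> * m)" unfolding half[symmetric]
    by (simp add: m_def midpoint_def scaleR_conv_of_real field_simps)
  have q: "q = m - s *\<^sub>R (\<i> * m)" unfolding half[symmetric]
    by (simp add: m_def midpoint_def scaleR_conv_of_real field_simps)
  have s0: "s \<noteq> 0"
  proof
    assume "s = 0"
    then have "p = m" using p by simp
    then show False using n \<open>norm m = 1\<close> by simp
  qed
  define e where "e = chart E (\<i> * m) - center E"
  have cp: "chart E p = chart E m + s *\<^sub>R e" and cq: "chart E q = chart E m + (-s) *\<^sub>R e"
    unfolding e_def chart_affine[symmetric] using p q by simp_all
  have "affine hull {chart E p, chart E q} = range (\<lambda>k. chart E m + k *\<^sub>R e)"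
  proof -
    have "affine hull {chart E p, chart E q} = range (\<lambda>k. chart E p + k *\<^sub>R (chart E q - chart E p))"
      by (auto simp: affine_hull_2_alt)
    also have "\<dots> = range (\<lambda>k. chart E m + (s - 2 * s * k) *\<^sub>R e)"
      unfolding cp cq by (intro image_cong refl) (simp add: complex_eq_iff algebra_simps)
    also have "\<dots> = (\<lambda>k. chart E m + k *\<^sub>R e) ` range (\<lambda>k. s - 2 * s * k)"
      by (simp add: image_image)
    also have "range (\<lambda>k. s - 2 * s * k) = UNIV"
      using s0 by (intro surjI[of _ "\<lambda>x. (s - x) / (2 * s)"]) (simp add: field_simps)
    finally show ?thesis .
  qed
  then have "tangent_line_at E t = affine hull {chart E p, chart E q}"
    unfolding tangent_line_chart t[symmetric] chart_affine e_def by simp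
  moreover have "ellipse_path E t = midpoint (chart E p) (chart E q)"
    unfolding chart_cis[symmetric] t[symmetric] m_def chart_midpoint ..
  ultimately show ?thesis unfolding tangent_to_side_at_midpoint_def by blast
qed

text \<open>The vertices satisfy \<open>(w \<bullet> p) p + (w \<bullet> q) q + (w \<bullet> r) r = 6 w\<close>, so \<open>w\<close> has the barycentric
  coordinates \<open>1/3 + (w \<bullet> p) / 6\<close> and so on, which are nonnegative as \<open>|w \<bullet> p| \<le> 2\<close>.\<close>

lemma equilateral_contains_circle:
  assumes eq: "p + q + r = 0" "norm p = 2" "norm q = 2" "norm r = 2" and w: "norm w = 1"
  shows "chart E w \<in> convex hull {chart E p, chart E q, chart E r}"
proof -
  define l where "l = (\<lambda>z. 1 / 3 + (w \<bullet> z) / 6)"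
  have pos: "l z \<ge> 0" if "norm z = 2" for z
    using Cauchy_Schwarz_ineq2[of w z] that w by (simp add: l_def)
  have "w \<bullet> p + w \<bullet> q + w \<bullet> r = 0" using eq(1) by (metis inner_add_right inner_zero_right)
  then have sum: "l p + l q + l r = 1" by (simp add: l_def)
  have inn: "of_real (w \<bullet> z) * z = (w * (z * cnj z) + cnj w * z\<^sup>2) / 2" for z
    by (simp add: complex_eq_iff inner_complex_def power2_eq_square algebra_simps)
  have c: "p * cnj p = 4" "q * cnj q = 4" "r * cnj r = 4"
    using eq by (simp_all add: complex_norm_square[symmetric])
  have "of_real (w \<bullet> p) * p + of_real (w \<bullet> q) * q + of_real (w \<bullet> r) * r
      = (12 * w + cnj w * (p\<^sup>2 + q\<^sup>2 + r\<^sup>2)) / 2"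
    unfolding inn c by (simp add: field_simps)
  then have "of_real (w \<bullet> p) * p + of_real (w \<bullet> q) * q + of_real (w \<bullet> r) * r = 6 * w"
    unfolding equilateral_sum_squares[OF eq] by simp
  moreover have "l p *\<^sub>R p + l q *\<^sub>R q + l r *\<^sub>R r = (p + q + r) / 3 +
      (of_real (w \<bullet> p) * p + of_real (w \<bullet> q) * q + of_real (w \<bullet> r) * r) / 6"
    by (simp add: l_def scaleR_conv_of_real field_simps)
  ultimately have "w = l p *\<^sub>R p + l q *\<^sub>R q + l r *\<^sub>R r" using eq(1) by simp
  then have "chart E w = l p *\<^sub>R chart E p + l q *\<^sub>R chart E q + l r *\<^sub>R chart E r"
    using chart_convex_combination[OF sum] by metis
  then show ?thesis
    unfolding convex_hull_3 using sum pos eq by blast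
qed

lemma siebeck_marden_chart:
  assumes E: "is_ellipse E" and sum: "p + q + r = 0" and n: "norm p = 2" "norm q = 2" "norm r = 2"
  shows "siebeck_marden_ellipse (chart E p) (chart E q) (chart E r) E"
  unfolding siebeck_marden_ellipse_def
proof (intro conjI E)
  show "range (ellipse_path E) \<subseteq> convex hull {chart E p, chart E q, chart E r}"
    using equilateral_contains_circle[OF assms(2-)] unfolding chart_cis[symmetric] by auto
  show "tangent_to_side_at_midpoint E (chart E p) (chart E q)"
    "tangent_to_side_at_midpoint E (chart E q) (chart E r)"
    "tangent_to_side_at_midpoint E (chart E r) (chart E p)"
    using equilateral_tangent_to_side[of p q r] equilateral_tangent_to_side[of q r p]
      equilateral_tangent_to_side[of r p q] assms by (simp_all add: ac_simps)
qed

text \<open>The primitive cube root of unity, used below for the Fourier transform of length three.\<close>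

definition omega :: complex where "omega = Complex (-1/2) (sqrt 3 / 2)"

lemma omega_facts:
  "norm omega = 1" "1 + omega + cnj omega = 0" "omega\<^sup>2 = cnj omega" "omega * cnj omega = 1"
proof -
  show "norm omega = 1" by (simp add: omega_def cmod_def power_divide)
  show "1 + omega + cnj omega = 0" by (simp add: omega_def complex_eq_iff)
  show "omega\<^sup>2 = cnj omega" by (simp add: omega_def complex_eq_iff power2_eq_square)
  show "omega * cnj omega = 1" by (simp add: omega_def complex_eq_iff)
qed

text \<open>The map \<open>z \<mapsto> m + \<alpha> z + \<gamma> \<cdot> cnj z\<close> sends the cube roots of unity to the triangle. Writing
  \<open>\<alpha> = |\<alpha>| u k\<close> and \<open>\<gamma> = |\<gamma>| u \<cdot> cnj k\<close> with units \<open>u\<close> and \<open>k\<close> turns it into the chart of the ellipse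
  with direction \<open>u\<close> and semi-axes \<open>(|\<alpha>| \<plusminus> |\<gamma>|) / 2\<close>, evaluated at \<open>2 k z\<close>. The strict inequality
  makes the minor semi-axis positive.\<close>

lemma siebeck_marden_exists_oriented:
  fixes m \<alpha> \<gamma> :: complex
  assumes "norm \<gamma> < norm \<alpha>"
  shows "\<exists>E. siebeck_marden_ellipse (m + \<alpha> + \<gamma>) (m + \<alpha> * omega + \<gamma> * cnj omega)
    (m + \<alpha> * cnj omega + \<gamma> * omega) E"
proof -
  define u where "u = cis ((Arg \<alpha> + Arg \<gamma>) / 2)"
  define k where "k = cis ((Arg \<alpha> - Arg \<gamma>) / 2)"
  define E where "E = Ellipse m u ((norm \<alpha> + norm \<gamma>) / 2) ((norm \<alpha> - norm \<gamma>) / 2)"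
  have al: "\<alpha> = norm \<alpha> * (u * k)"
    using rcis_cmod_Arg[of \<alpha>] by (simp add: u_def k_def cis_mult rcis_def field_simps)
  have ga: "\<gamma> = norm \<gamma> * (u * cnj k)"
    using rcis_cmod_Arg[of \<gamma>] by (simp add: u_def k_def cis_mult cis_cnj rcis_def field_simps)
  have E: "is_ellipse E" using assms by (simp add: is_ellipse_def E_def u_def)
  have ch: "chart E (2 * k * z) = m + \<alpha> * z + \<gamma> * cnj z" for z
  proof -
    have "chart E (2 * k * z) = m + (norm \<alpha> * (u * k)) * z + (norm \<gamma> * (u * cnj k)) * cnj z"
      unfolding chart_cnj by (simp add: E_def field_simps)
    then show ?thesis by (simp flip: al ga)
  qed
  have nk: "norm k = 1" by (simp add: k_def)
  have "siebeck_marden_ellipse (chart E (2 * k * 1)) (chart E (2 * k * omega)) (chart E (2 * k * cnj omega)) E"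
  proof (rule siebeck_marden_chart[OF E])
    have "2 * k * 1 + 2 * k * omega + 2 * k * cnj omega = 2 * k * (1 + omega + cnj omega)"
      by (simp add: algebra_simps)
    then show "2 * k * 1 + 2 * k * omega + 2 * k * cnj omega = 0" by (simp add: omega_facts)
  qed (simp_all add: norm_mult nk omega_facts)
  then show ?thesis unfolding ch by auto
qed

lemma triangle_fourier:
  fixes a b c :: complex
  defines "\<alpha> \<equiv> (a + cnj omega * b + omega * c) / 3" and "\<gamma> \<equiv> (a + omega * b + cnj omega * c) / 3"
    and "m \<equiv> barycenter a b c"
  shows "a = m + \<alpha> + \<gamma>" "b = m + \<alpha> * omega + \<gamma> * cnj omega" "c = m + \<alpha> * cnj omega + \<gamma> * omega"
proof -
  have w: "cnj omega = -1 - omega" using omega_facts(2) by (simp add: algebra_simps eq_neg_iff_add_eq_0)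
  have w2: "omega * omega = -1 - omega" using omega_facts(3) w by (simp add: power2_eq_square)
  have w3: "omega * (omega * x) = - x - omega * x" for x
    unfolding mult.assoc[symmetric] w2 by (simp add: algebra_simps)
  show "a = m + \<alpha> + \<gamma>" "b = m + \<alpha> * omega + \<gamma> * cnj omega" "c = m + \<alpha> * cnj omega + \<gamma> * omega"
    unfolding \<alpha>_def \<gamma>_def m_def barycenter_def w by (simp_all add: field_simps w2 w3)
qed

text \<open>The same factorization with \<open>|\<alpha>| = |\<gamma>|\<close> collapses the ellipse to a segment in the direction
  \<open>u\<close>, as \<open>k z + cnj (k z)\<close> is real.\<close>

lemma equal_fourier_norms_collinear:
  fixes m \<alpha> \<gamma> :: complex
  assumes "norm \<alpha> = norm \<gamma>"
  shows "collinear {m + \<alpha> + \<gamma>, m + \<alpha> * omega + \<gamma> * cnj omega, m + \<alpha> * cnj omega + \<gamma> * omega}"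
proof -
  define u where "u = cis ((Arg \<alpha> + Arg \<gamma>) / 2)"
  define k where "k = norm \<alpha> * cis ((Arg \<alpha> - Arg \<gamma>) / 2)"
  have al: "\<alpha> = u * k"
    using rcis_cmod_Arg[of \<alpha>] by (simp add: u_def k_def cis_mult rcis_def field_simps)
  have ga: "\<gamma> = u * cnj k"
    using rcis_cmod_Arg[of \<gamma>] unfolding assms[symmetric]
    by (simp add: u_def k_def cis_mult cis_cnj rcis_def field_simps)
  have pt: "m + \<alpha> * z + \<gamma> * cnj z = m + (2 * Re (k * z)) *\<^sub>R u" for z
    unfolding al ga by (simp add: complex_eq_iff algebra_simps)
  have "m + \<alpha> + \<gamma> = m + (2 * Re (k * 1)) *\<^sub>R u"
    "m + \<alpha> * omega + \<gamma> * cnj omega = m + (2 * Re (k * omega)) *\<^sub>R u"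
    "m + \<alpha> * cnj omega + \<gamma> * omega = m + (2 * Re (k * cnj omega)) *\<^sub>R u"
    using pt[of 1] pt[of omega] pt[of "cnj omega"] by simp_all
  then show ?thesis unfolding collinear_alt by blast
qed

lemma siebeck_marden_ellipse_swap:
  "siebeck_marden_ellipse a c b E \<Longrightarrow> siebeck_marden_ellipse a b c E"
  unfolding siebeck_marden_ellipse_def tangent_to_side_at_midpoint_def
  by (simp add: midpoint_sym insert_commute)

lemma siebeck_marden_exists:
  assumes "\<not> collinear {a, b, c}"
  shows "\<exists>E. siebeck_marden_ellipse a b c E"
proof -
  obtain m \<alpha> \<gamma> where abc: "a = m + \<alpha> + \<gamma>" "b = m + \<alpha> * omega + \<gamma> * cnj omega"
      "c = m + \<alpha> * cnj omega + \<gamma> * omega"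
    using triangle_fourier by blast
  have "norm \<alpha> \<noteq> norm \<gamma>" using equal_fourier_norms_collinear assms unfolding abc by blast
  then consider "norm \<gamma> < norm \<alpha>" | "norm \<alpha> < norm \<gamma>" by linarith
  then show ?thesis
  proof cases
    case 1
    then show ?thesis unfolding abc by (rule siebeck_marden_exists_oriented)
  next
    case 2
    (* Swapping b and c swaps the two Fourier coefficients. *)
    from siebeck_marden_exists_oriented[OF 2, of m] have "\<exists>E. siebeck_marden_ellipse a c b E"
      unfolding abc by (simp add: ac_simps)
    then show ?thesis using siebeck_marden_ellipse_swap by blast
  qed
qed

section \<open>The critical points lie on the axes\<close>

lemma critical_points_axes_of_ellipse:
  assumes nc: "\<not> collinear {a, b, c}" and B0: "B_tri a b c \<noteq> 0" and S: "siebeck_marden_ellipse a b c E"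
  defines "C \<equiv> critical_points (graph_curvature (cubic a b c))"
  shows "C \<subseteq> major_axis_line E \<union> minor_axis_line E" "\<not> C \<subseteq> major_axis_line E"
    "\<not> C \<subseteq> minor_axis_line E" "barycenter a b c \<in> C"
proof -
  define v where "v = major_dir E"
  define \<beta> where "\<beta> = (semi_major E)\<^sup>2 - (semi_minor E)\<^sup>2"
  have E: "is_ellipse E" using S by (simp add: siebeck_marden_ellipse_def)
  have cen: "center E = barycenter a b c" and B: "B_tri a b c = v\<^sup>2 * of_real \<beta>"
    using siebeck_marden_center_and_B[OF nc S] by (simp_all add: v_def \<beta>_def)
  have v: "norm v = 1" and "\<beta> \<ge> 0"
    using E by (auto simp: is_ellipse_def v_def \<beta>_def intro!: power_mono)
  with B B0 have \<beta>: "\<beta> > 0" by (cases "\<beta> = 0") auto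
  have v0: "v \<noteq> 0" using v by auto
  obtain x y where xy: "x > 0" "y > 0" and C: "C = (\<lambda>\<xi>. barycenter a b c + v * \<xi>) `
      {0, Complex x 0, Complex (-x) 0, Complex 0 y, Complex 0 (-y)}"
    unfolding C_def by (rule critical_points_on_axes[OF v \<beta> B])
  have maj: "barycenter a b c + v * \<xi> \<in> major_axis_line E \<longleftrightarrow> Im \<xi> = 0" for \<xi>
  proof
    assume "Im \<xi> = 0"
    then have "v * \<xi> = Re \<xi> *\<^sub>R v" by (simp add: complex_eq_iff)
    then show "barycenter a b c + v * \<xi> \<in> major_axis_line E"
      unfolding major_axis_line_def cen v_def by auto
  next
    assume "barycenter a b c + v * \<xi> \<in> major_axis_line E"
    then obtain s :: real where "v * \<xi> = v * of_real s"
      unfolding major_axis_line_def cen v_def by (auto simp: scaleR_conv_of_real mult.commute)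
    then show "Im \<xi> = 0" using v0 by simp
  qed
  have min: "barycenter a b c + v * \<xi> \<in> minor_axis_line E \<longleftrightarrow> Re \<xi> = 0" for \<xi>
  proof
    assume "Re \<xi> = 0"
    then have "v * \<xi> = Im \<xi> *\<^sub>R (\<i> * v)" by (simp add: complex_eq_iff)
    then show "barycenter a b c + v * \<xi> \<in> minor_axis_line E"
      unfolding minor_axis_line_def cen v_def by auto
  next
    assume "barycenter a b c + v * \<xi> \<in> minor_axis_line E"
    then obtain s :: real where "v * \<xi> = v * (\<i> * of_real s)"
      unfolding minor_axis_line_def cen v_def by (auto simp: scaleR_conv_of_real mult_ac)
    then show "Re \<xi> = 0" using v0 by simp
  qed
  show "C \<subseteq> major_axis_line E \<union> minor_axis_line E" "\<not> C \<subseteq> major_axis_line E"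
    "\<not> C \<subseteq> minor_axis_line E"
    unfolding C using xy maj[of 0] min[of 0] by (simp_all add: maj min)
  show "barycenter a b c \<in> C" unfolding C by simp
qed

theorem theorem4p2:
  fixes a b c :: complex
  assumes "\<not> collinear {a, b, c}"
    and "B_tri a b c \<noteq> 0"
  shows "card (critical_points (graph_curvature (cubic a b c))) = 5 \<and>
    (\<exists>E. siebeck_marden_ellipse a b c E) \<and>
    (\<forall>E. siebeck_marden_ellipse a b c E \<longrightarrow>
       critical_points (graph_curvature (cubic a b c)) \<subseteq> major_axis_line E \<union> minor_axis_line E \<and>
       \<not> critical_points (graph_curvature (cubic a b c)) \<subseteq> major_axis_line E \<and>
       \<not> critical_points (graph_curvature (cubic a b c)) \<subseteq> minor_axis_line E \<and>
       barycenter a b c \<in> critical_points (graph_curvature (cubic a b c)) \<and>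
       center E = barycenter a b c)"
proof (intro conjI allI impI)
  show "card (critical_points (graph_curvature (cubic a b c))) = 5"
    by (rule card_critical_points[OF assms(2)])
  show "\<exists>E. siebeck_marden_ellipse a b c E"
    by (rule siebeck_marden_exists[OF assms(1)])
qed (rule critical_points_axes_of_ellipse[OF assms] siebeck_marden_center_and_B(1)[OF assms(1)]; assumption)+

end
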